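(* Let $(\mathcal{P},\mathcal{H})$ be an intersection-closed hypothesis space whose collection $\{H_P : P\in\mathcal{P}\}$ of least hypotheses is at most countable. If $\varepsilon:\mathcal{H}\times\mathcal{X}\to[0,\infty]$ is an E-capacity kernel, then its closure $\overline{\varepsilon}$ (taken for each fixed $x$) is an E-measure kernel that dominates $\varepsilon$, i.e. $\overline{\varepsilon}(H\mid x)\ge\varepsilon(H\mid x)$ for all $H\in\mathcal{H}$, $x\in\mathcal{X}$. Moreover, $\varepsilon$ is valid if and only if $\overline{\varepsilon}$ is valid.
   Context: $(\mathcal{X},\Sigma)$ is a measurable space and $\mathcal{P}$ is a collection of probability measures on it. A hypothesis class $\mathcal{H}$ is a collection of subsets of $\mathcal{P}$ closed under arbitrary unions (including the empty union, so $\emptyset\in\mathcal{H}$); $(\mathcal{P},\mathcal{H})$ is then a hypothesis space. It is intersection-closed if $\mathcal{H}$ is also closed under arbitrary intersections and $\mathcal{P}\in\mathcal{H}$. In that case each $P\in\mathcal{P}$ has a least hypothesis $H_P=\bigcap\{H\in\mathcal{H}:P\in H\}\in\mathcal{H}$. An E-function is a map $\varepsilon:\mathcal{H}\to[0,\infty]$ with $\varepsilon(\emptyset)=\infty$. An E-capacity is an E-function with $\varepsilon(H')\le\varepsilon(H)$ whenever $H\subseteq H'$, $H,H'\in\mathcal{H}$. An E-measure is a map $\varepsilon:\mathcal{H}\to[0,\infty]$ with $\varepsilon(\bigcup_{H\in\mathcal{S}}H)=\inf_{H\in\mathcal{S}}\varepsilon(H)$ for every $\mathcal{S}\subseteq\mathcal{H}$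 (with $\inf\emptyset=\infty$). The closure of an E-function $\varepsilon$ is $$\overline{\varepsilon}(H)=\sup_{\mathcal{T}}\inf_{H'\in\mathcal{T}}\varepsilon(H'),$$ where the supremum is over all covers of $H$, i.e. all $\mathcal{T}\subseteq\mathcal{H}$ with $H\subseteq\bigcup_{H'\in\mathcal{T}}H'$. An E-capacity kernel (resp. E-measure kernel) is a map $\varepsilon:\mathcal{H}\times\mathcal{X}\to[0,\infty]$, written $\varepsilon(H\mid x)$, such that $x\mapsto\varepsilon(H\mid x)$ is $\Sigma$-measurable for every $H\in\mathcal{H}$ and $H\mapsto\varepsilon(H\mid x)$ is an E-capacity (resp. E-measure) for every $x\in\mathcal{X}$. The closure of a kernel is defined pointwise in $x$. A kernel is (hypothesis-wise) valid if $\mathbb{E}^P[\varepsilon(H\mid X)]\le1$ for every nonempty $H\in\mathcal{H}$ and every $P\in H$, where $\mathbb{E}^P$ is expectation when $X\in\mathcal{X}$ has law $P$. *)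

theory Defs
  imports "HOL-Probability.Probability"
begin

text \<open>
  The measurable space is given by \<open>space M\<close> and \<open>sets M\<close>; the measure carried by \<open>M\<close> is irrelevant.
\<close>

locale hypothesis_space =
  fixes M :: "'a measure" and \<P> :: "'a measure set" and \<H> :: "'a measure set set"
  assumes prob_space: "P \<in> \<P> \<Longrightarrow> prob_space P"
    and sets_eq: "P \<in> \<P> \<Longrightarrow> sets P = sets M"
    and hypotheses_subset: "H \<in> \<H> \<Longrightarrow> H \<subseteq> \<P>"
    and Union_closed: "\<S> \<subseteq> \<H> \<Longrightarrow> \<Union>\<S> \<in> \<H>"

text \<open>
  In type \<open>'a measure set\<close> the empty intersection would be \<open>UNIV\<close>; relative to \<open>\<P>\<close> it is \<open>\<P>\<close> itself,
  whence the separate assumption.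
\<close>

locale intersection_closed_hypothesis_space = hypothesis_space +
  assumes Inter_closed: "\<S> \<subseteq> \<H> \<Longrightarrow> \<S> \<noteq> {} \<Longrightarrow> \<Inter>\<S> \<in> \<H>"
    and whole_hypothesis: "\<P> \<in> \<H>"

definition least_hypothesis :: "'p set set \<Rightarrow> 'p \<Rightarrow> 'p set" where
  "least_hypothesis \<H> P = \<Inter>{H \<in> \<H>. P \<in> H}"

definition E_function :: "'p set set \<Rightarrow> ('p set \<Rightarrow> ennreal) \<Rightarrow> bool" where
  "E_function \<H> e \<longleftrightarrow> e {} = \<infinity>"

definition E_capacity :: "'p set set \<Rightarrow> ('p set \<Rightarrow> ennreal) \<Rightarrow> bool" where
  "E_capacity \<H> e \<longleftrightarrow> E_function \<H> e \<and> (\<forall>H\<in>\<H>. \<forall>H'\<in>\<H>. H \<subseteq> H' \<longrightarrow> e H' \<le> e H)"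

text \<open>In \<open>ennreal\<close> the infimum over the empty family is \<open>\<infinity>\<close>.\<close>

definition E_measure :: "'p set set \<Rightarrow> ('p set \<Rightarrow> ennreal) \<Rightarrow> bool" where
  "E_measure \<H> e \<longleftrightarrow> (\<forall>\<S>. \<S> \<subseteq> \<H> \<longrightarrow> e (\<Union>\<S>) = (INF H\<in>\<S>. e H))"

definition E_closure :: "'p set set \<Rightarrow> ('p set \<Rightarrow> ennreal) \<Rightarrow> 'p set \<Rightarrow> ennreal" where
  "E_closure \<H> e H = (SUP \<T>\<in>{\<T>. \<T> \<subseteq> \<H> \<and> H \<subseteq> \<Union>\<T>}. INF H'\<in>\<T>. e H')"

definition E_capacity_kernel ::
    "'a measure \<Rightarrow> 'a measure set set \<Rightarrow> ('a measure set \<Rightarrow> 'a \<Rightarrow> ennreal) \<Rightarrow> bool" where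
  "E_capacity_kernel M \<H> \<epsilon> \<longleftrightarrow>
     (\<forall>H\<in>\<H>. \<epsilon> H \<in> borel_measurable M) \<and> (\<forall>x\<in>space M. E_capacity \<H> (\<lambda>H. \<epsilon> H x))"

definition E_measure_kernel ::
    "'a measure \<Rightarrow> 'a measure set set \<Rightarrow> ('a measure set \<Rightarrow> 'a \<Rightarrow> ennreal) \<Rightarrow> bool" where
  "E_measure_kernel M \<H> \<epsilon> \<longleftrightarrow>
     (\<forall>H\<in>\<H>. \<epsilon> H \<in> borel_measurable M) \<and> (\<forall>x\<in>space M. E_measure \<H> (\<lambda>H. \<epsilon> H x))"

definition kernel_closure ::
    "'a measure set set \<Rightarrow> ('a measure set \<Rightarrow> 'a \<Rightarrow> ennreal) \<Rightarrow> 'a measure set \<Rightarrow> 'a \<Rightarrow> ennreal" where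
  "kernel_closure \<H> \<epsilon> H x = E_closure \<H> (\<lambda>H'. \<epsilon> H' x) H"

definition valid_kernel ::
    "'a measure set set \<Rightarrow> ('a measure set \<Rightarrow> 'a \<Rightarrow> ennreal) \<Rightarrow> bool" where
  "valid_kernel \<H> \<epsilon> \<longleftrightarrow> (\<forall>H\<in>\<H>. H \<noteq> {} \<longrightarrow> (\<forall>P\<in>H. (\<integral>\<^sup>+x. \<epsilon> H x \<partial>P) \<le> 1))"

end

theory Submission
  imports Defs
begin

text \<open>
  Among the covers of \<open>H\<close> the family of least hypotheses \<open>H\<^sub>P\<close> with \<open>P \<in> H\<close> is the finest one, so it
  attains the supremum: the closure of a capacity \<open>e\<close> at \<open>H\<close> is the infimum of \<open>e H\<^sub>P\<close> over \<open>P \<in> H\<close>.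
  Such an infimum turns unions into infima, and countably many values \<open>H\<^sub>P\<close> make it measurable.
  For \<open>P \<in> H\<close> the closure at \<open>H\<close> is at most \<open>e H\<^sub>P\<close>, whose \<open>P\<close>-expectation is bounded by validity
  of \<open>e\<close> at \<open>H\<^sub>P\<close> itself.
\<close>

lemma mem_least_hypothesis: "P \<in> least_hypothesis \<H> P"
  by (simp add: least_hypothesis_def)

lemma least_hypothesis_subset: "H \<in> \<H> \<Longrightarrow> P \<in> H \<Longrightarrow> least_hypothesis \<H> P \<subseteq> H"
  by (auto simp: least_hypothesis_def)

lemma (in intersection_closed_hypothesis_space) least_hypothesis_in:
  assumes "P \<in> \<P>"
  shows "least_hypothesis \<H> P \<in> \<H>"
  unfolding least_hypothesis_def
  \<comment> \<open>By \<open>whole_hypothesis\<close>, \<open>\<P>\<close> is one of the hypotheses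
    containing \<open>P\<close>, so the intersected family is nonempty.\<close>
  by (rule Inter_closed) (use assms whole_hypothesis in auto)

lemma E_closure_ge: "H \<in> \<H> \<Longrightarrow> e H \<le> E_closure \<H> e H"
  unfolding E_closure_def by (rule SUP_upper2[of "{H}"]) auto

lemma (in intersection_closed_hypothesis_space) E_closure_eq_INF:
  assumes e: "E_capacity \<H> e" and H: "H \<in> \<H>"
  shows "E_closure \<H> e H = (INF P\<in>H. e (least_hypothesis \<H> P))"
proof (rule antisym)
  have least: "least_hypothesis \<H> P \<in> \<H>" if "P \<in> H" for P
    using hypotheses_subset[OF H] least_hypothesis_in that by blast
  show "E_closure \<H> e H \<le> (INF P\<in>H. e (least_hypothesis \<H> P))"
    unfolding E_closure_def
  proof (intro SUP_least INF_greatest)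
    fix \<T> P assume \<T>: "\<T> \<in> {\<T>. \<T> \<subseteq> \<H> \<and> H \<subseteq> \<Union>\<T>}" and P: "P \<in> H"
    then obtain H' where H': "H' \<in> \<T>" "H' \<in> \<H>" "P \<in> H'"
      by blast
    \<comment> \<open>A cover must catch \<open>P\<close> in some member \<open>H'\<close>; that
      member includes the least hypothesis, and a capacity is antitone.\<close>
    then have "e H' \<le> e (least_hypothesis \<H> P)"
      using e least[OF P] least_hypothesis_subset[of H' \<H> P] by (auto simp: E_capacity_def)
    with H' show "(INF H'\<in>\<T>. e H') \<le> e (least_hypothesis \<H> P)"
      by (meson INF_lower2)
  qed
  \<comment> \<open>The witness for the supremum. For empty \<open>H\<close> it is the empty cover,
    whose infimum is \<infinity>.\<close>
  have "H \<subseteq> \<Union>(least_hypothesis \<H> ` H)"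
    using mem_least_hypothesis by fast
  then show "(INF P\<in>H. e (least_hypothesis \<H> P)) \<le> E_closure \<H> e H"
    unfolding E_closure_def
    by (intro SUP_upper2[of "least_hypothesis \<H> ` H"]) (use least in \<open>auto simp: image_image\<close>)
qed

lemma (in intersection_closed_hypothesis_space) E_measure_E_closure:
  assumes e: "E_capacity \<H> e"
  shows "E_measure \<H> (E_closure \<H> e)"
  unfolding E_measure_def
proof (intro allI impI)
  fix \<S> assume \<S>: "\<S> \<subseteq> \<H>"
  have "E_closure \<H> e (\<Union>\<S>) = (INF P\<in>\<Union>\<S>. e (least_hypothesis \<H> P))"
    by (rule E_closure_eq_INF[OF e Union_closed[OF \<S>]])
  \<comment> \<open>An infimum over a union splits into iterated infima; if \<open>\<S>\<close> is
    empty, both sides are \<infinity>.\<close>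
  also have "\<dots> = (INF H\<in>\<S>. INF P\<in>H. e (least_hypothesis \<H> P))"
    by (intro antisym INF_greatest) (auto intro: INF_lower INF_lower2)
  also have "\<dots> = (INF H\<in>\<S>. E_closure \<H> e H)"
    by (rule INF_cong) (use E_closure_eq_INF[OF e] \<S> in auto)
  finally show "E_closure \<H> e (\<Union>\<S>) = (INF H\<in>\<S>. E_closure \<H> e H)" .
qed

lemma (in intersection_closed_hypothesis_space) measurable_kernel_closure:
  assumes \<epsilon>: "E_capacity_kernel M \<H> \<epsilon>" and H: "H \<in> \<H>"
    and cnt: "countable (least_hypothesis \<H> ` \<P>)"
  shows "kernel_closure \<H> \<epsilon> H \<in> borel_measurable M"
proof -
  have sub: "H \<subseteq> \<P>"
    by (rule hypotheses_subset[OF H])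
  \<comment> \<open>\<open>H\<close> itself may be uncountable, so the infimum is indexed by the
    distinct least hypotheses instead of by the points of \<open>H\<close>.\<close>
  have "countable (least_hypothesis \<H> ` H)"
    using cnt by (rule countable_subset[rotated]) (use sub in auto)
  moreover have "\<epsilon> G \<in> borel_measurable M" if "G \<in> least_hypothesis \<H> ` H" for G
    using that sub least_hypothesis_in \<epsilon> by (auto simp: E_capacity_kernel_def)
  ultimately have "(\<lambda>x. INF G\<in>least_hypothesis \<H> ` H. \<epsilon> G x) \<in> borel_measurable M"
    by (intro borel_measurable_INF) auto
  then show ?thesis
    by (rule measurable_cong[THEN iffD1, rotated])
       (use E_closure_eq_INF[OF _ H] \<epsilon> in
         \<open>auto simp: kernel_closure_def E_capacity_kernel_def image_image\<close>)
qed

lemma (in intersection_closed_hypothesis_space) valid_kernel_closure_iff: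
  assumes \<epsilon>: "E_capacity_kernel M \<H> \<epsilon>"
  shows "valid_kernel \<H> \<epsilon> \<longleftrightarrow> valid_kernel \<H> (kernel_closure \<H> \<epsilon>)"
  unfolding valid_kernel_def
proof (intro iffI ballI impI)
  fix H P
  assume v: "\<forall>H\<in>\<H>. H \<noteq> {} \<longrightarrow> (\<forall>P\<in>H. (\<integral>\<^sup>+x. \<epsilon> H x \<partial>P) \<le> 1)"
    and H: "H \<in> \<H>" and P: "P \<in> H"
  have P\<P>: "P \<in> \<P>"
    using hypotheses_subset[OF H] P by blast
  have "(\<integral>\<^sup>+x. kernel_closure \<H> \<epsilon> H x \<partial>P) \<le> (\<integral>\<^sup>+x. \<epsilon> (least_hypothesis \<H> P) x \<partial>P)"
  proof (rule nn_integral_mono)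
    \<comment> \<open>The kernel is a capacity at points of \<open>space M\<close>, and
      \<open>P\<close> lives on that same space.\<close>
    fix x assume "x \<in> space P"
    then have "E_capacity \<H> (\<lambda>H. \<epsilon> H x)"
      using \<epsilon> sets_eq_imp_space_eq[OF sets_eq[OF P\<P>]] by (simp add: E_capacity_kernel_def)
    then show "kernel_closure \<H> \<epsilon> H x \<le> \<epsilon> (least_hypothesis \<H> P) x"
      using INF_lower[OF P, of "\<lambda>P. \<epsilon> (least_hypothesis \<H> P) x"] E_closure_eq_INF[OF _ H]
      by (simp add: kernel_closure_def)
  qed
  \<comment> \<open>Validity is applied at the least hypothesis of \<open>P\<close>, which contains
    \<open>P\<close> and is thus nonempty.\<close>
  also have "\<dots> \<le> 1"
    using v least_hypothesis_in[OF P\<P>] mem_least_hypothesis[of P \<H>] by blast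
  finally show "(\<integral>\<^sup>+x. kernel_closure \<H> \<epsilon> H x \<partial>P) \<le> 1" .
next
  fix H P
  assume v: "\<forall>H\<in>\<H>. H \<noteq> {} \<longrightarrow> (\<forall>P\<in>H. (\<integral>\<^sup>+x. kernel_closure \<H> \<epsilon> H x \<partial>P) \<le> 1)"
    and H: "H \<in> \<H>" and P: "P \<in> H"
  \<comment> \<open>Domination, which comes from the one-element cover \<open>{H}\<close>, carries
    the bound from the closure down to \<open>\<epsilon>\<close>.\<close>
  have "(\<integral>\<^sup>+x. \<epsilon> H x \<partial>P) \<le> (\<integral>\<^sup>+x. kernel_closure \<H> \<epsilon> H x \<partial>P)"
    by (rule nn_integral_mono)
       (use E_closure_ge[OF H] in \<open>auto simp: kernel_closure_def\<close>)
  also have "\<dots> \<le> 1"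
    using v H P by blast
  finally show "(\<integral>\<^sup>+x. \<epsilon> H x \<partial>P) \<le> 1" .
qed

theorem theorem3:
  fixes M :: "'a measure" and \<P> :: "'a measure set" and \<H> :: "'a measure set set"
    and \<epsilon> :: "'a measure set \<Rightarrow> 'a \<Rightarrow> ennreal"
  assumes "intersection_closed_hypothesis_space M \<P> \<H>"
    and "countable (least_hypothesis \<H> ` \<P>)"
    and "E_capacity_kernel M \<H> \<epsilon>"
  shows "E_measure_kernel M \<H> (kernel_closure \<H> \<epsilon>)
    \<and> (\<forall>H\<in>\<H>. \<forall>x\<in>space M. kernel_closure \<H> \<epsilon> H x \<ge> \<epsilon> H x)
    \<and> (valid_kernel \<H> \<epsilon> \<longleftrightarrow> valid_kernel \<H> (kernel_closure \<H> \<epsilon>))"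
proof -
  interpret intersection_closed_hypothesis_space M \<P> \<H>
    by (rule assms(1))
  have "E_measure_kernel M \<H> (kernel_closure \<H> \<epsilon>)"
    using measurable_kernel_closure[OF assms(3) _ assms(2)] E_measure_E_closure assms(3)
    by (simp add: E_measure_kernel_def E_capacity_kernel_def kernel_closure_def)
  moreover have "\<forall>H\<in>\<H>. \<forall>x\<in>space M. kernel_closure \<H> \<epsilon> H x \<ge> \<epsilon> H x"
    by (auto simp: kernel_closure_def intro: E_closure_ge)
  ultimately show ?thesis
    using valid_kernel_closure_iff[OF assms(3)] by blast
qed

end
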